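(* Let $n\ge2$ and $m\ge1$ be integers, and let $s\in\mathbb{R}^n$ have pairwise distinct components. Let $A$ be chosen uniformly at random from the set $S$ of matrices in $\{0,1\}^{m\times n^2}$ in which every row contains exactly two ones, and let $M(A)$ be the number of codewords of $\Lambda(\theta(A),0,\unlhd,s)$, where $\unlhd=(=,\dots,=)$. Then $$\mathsf{E}[M(A)]=n!\left(\frac{\binom n2+\binom{n^2-n}2}{\binom{n^2}2}\right)^m .$$
   Context: $\Pi_n$ is the set of $n\times n$ permutation matrices; $\mathrm{vec}(X)\in\mathbb{R}^{n^2}$ is the row-by-row vectorization of $X$. The map $\theta:S\to\{-1,0,1\}^{m\times n^2}$ flips the sign of the first nonzero entry in each row: $B=\theta(A)$ has $B_{i,j}=-A_{i,j}$ if $A_{i,j'}=0$ for all $j'<j$, and $B_{i,j}=A_{i,j}$ otherwise; thus $\theta(A)\,\mathrm{vec}(X)=0$ is a system of $m$ equalities, each between two entries of $X$. The code is $\Lambda(\theta(A),0,\unlhd,s)=\{Xs : X\in\Pi_n,\ \theta(A)\,\mathrm{vec}(X)=0\}$. Each matrix in $S$ has probability $P(A)=\binom{n^2}{2}^{-m}$, and $\mathsf{E}$ is expectation with respect to $P$. *)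

theory Defs
  imports
    "HOL-Probability.Probability_Mass_Function"
    "Jordan_Normal_Form.Matrix"
begin

no_notation Finite_Cartesian_Product.vec_nth (infixl "$" 90)

definition perm_matrices :: "nat \<Rightarrow> real mat set" where
  "perm_matrices n = {X \<in> carrier_mat n n.
     (\<forall>i<n. \<forall>j<n. X $$ (i, j) \<in> {0, 1}) \<and>
     (\<forall>i<n. \<exists>!j. j < n \<and> X $$ (i, j) = 1) \<and>
     (\<forall>j<n. \<exists>!i. i < n \<and> X $$ (i, j) = 1)}"

definition vectorize :: "'a mat \<Rightarrow> 'a vec" where
  "vectorize X = vec (dim_row X * dim_col X)
     (\<lambda>k. X $$ (k div dim_col X, k mod dim_col X))"

text \<open>The relation vector is a function: \<open>rel i\<close> is the relation imposed
  in row \<open>i\<close>, and only its values for \<open>i < dim_row A\<close> matter.\<close>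

definition perm_code ::
  "real mat \<Rightarrow> real vec \<Rightarrow> (nat \<Rightarrow> real \<Rightarrow> real \<Rightarrow> bool) \<Rightarrow> real vec \<Rightarrow> real vec set" where
  "perm_code A b rel s = {X *\<^sub>v s | X. X \<in> perm_matrices (dim_vec s) \<and>
     (\<forall>i<dim_row A. rel i ((A *\<^sub>v vectorize X) $ i) (b $ i))}"

definition two_ones_matrices :: "nat \<Rightarrow> nat \<Rightarrow> real mat set" where
  "two_ones_matrices m n = {A \<in> carrier_mat m (n\<^sup>2).
     (\<forall>i<m. \<forall>j<n\<^sup>2. A $$ (i, j) \<in> {0, 1}) \<and>
     (\<forall>i<m. card {j. j < n\<^sup>2 \<and> A $$ (i, j) = 1} = 2)}"

definition flip_first :: "real mat \<Rightarrow> real mat" where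
  "flip_first A = mat (dim_row A) (dim_col A)
     (\<lambda>(i, j). if \<forall>j'<j. A $$ (i, j') = 0 then - A $$ (i, j) else A $$ (i, j))"

end

theory Submission
  imports Defs
begin

text \<open>Since \<open>s\<close> has distinct entries, \<open>X \<mapsto> X s\<close> is injective on permutation matrices, so the
  sum of \<open>M(A)\<close> over all \<open>A\<close> counts the pairs \<open>(A, X)\<close> such that \<open>X\<close> takes equal values on the two
  positions marked in each row of \<open>A\<close>. For a fixed \<open>X\<close> the rows of \<open>A\<close> can be chosen
  independently, each as a 2-subset of the \<open>n\<close> ones or of the \<open>n\<^sup>2 - n\<close> zeros of \<open>X\<close>.\<close>

section \<open>Permutation matrices and permutations\<close>

definition perm_mat :: "nat \<Rightarrow> (nat \<Rightarrow> nat) \<Rightarrow> real mat" where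
  "perm_mat n p = mat n n (\<lambda>(i, j). if j = p i then 1 else 0)"

lemma perm_mat_in_perm_matrices:
  assumes p: "p permutes {..<n}"
  shows "perm_mat n p \<in> perm_matrices n"
proof -
  have lt: "p i < n" if "i < n" for i
    using permutes_in_image[OF p, of i] that by simp
  have "\<exists>!i. i < n \<and> perm_mat n p $$ (i, j) = 1" if "j < n" for j
  proof -
    have "j \<in> p ` {..<n}" using permutes_image[OF p] that by simp
    then obtain i where i: "i < n" "p i = j" by auto
    show ?thesis
    proof (rule ex1I[of _ i])
      show "i < n \<and> perm_mat n p $$ (i, j) = 1" using i that by (simp add: perm_mat_def)
    next
      fix k assume "k < n \<and> perm_mat n p $$ (k, j) = 1"
      then have "p k = j" using that by (auto simp: perm_mat_def split: if_splits)
      then show "k = i" using i permutes_inj[OF p] by (metis injD)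
    qed
  qed
  moreover have "\<exists>!j. j < n \<and> perm_mat n p $$ (i, j) = 1" if "i < n" for i
    by (rule ex1I[of _ "p i"])
      (use that lt[OF that] in \<open>auto simp: perm_mat_def split: if_splits\<close>)
  moreover have "perm_mat n p \<in> carrier_mat n n"
    and "\<forall>i<n. \<forall>j<n. perm_mat n p $$ (i, j) \<in> {0, 1}"
    by (simp_all add: perm_mat_def)
  ultimately show ?thesis
    unfolding perm_matrices_def by blast
qed

text \<open>Sending each row to the column of its one gives a map \<open>p\<close>. It is injective
  since no column contains two ones, hence a bijection of the finite set \<open>{..<n}\<close>.
  Entries other than ones are zeros, so \<open>p\<close> determines the matrix.\<close>

lemma perm_matrices_eq: "perm_matrices n = perm_mat n ` {p. p permutes {..<n}}"
proof (intro subset_antisym subsetI)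
  fix X assume X: "X \<in> perm_matrices n"
  \<comment> \<open>The identity outside \<open>{..<n}\<close> is what \<open>permutes\<close>
    demands there.\<close>
  define p where "p i = (if i < n then THE j. j < n \<and> X $$ (i, j) = 1 else i)" for i
  have p: "p i < n" "X $$ (i, p i) = 1" if "i < n" for i
  proof -
    have "\<exists>!j. j < n \<and> X $$ (i, j) = 1" using X that by (simp add: perm_matrices_def)
    from theI'[OF this] show "p i < n" "X $$ (i, p i) = 1" using that by (auto simp: p_def)
  qed
  have p_eq: "j = p i" if "i < n" "j < n" "X $$ (i, j) = 1" for i j
    using X p[OF that(1)] that unfolding perm_matrices_def by blast
  have inj: "inj_on p {..<n}"
  proof (rule inj_onI)
    fix i k assume ik: "i \<in> {..<n}" "k \<in> {..<n}" "p i = p k"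
    have "\<exists>!l. l < n \<and> X $$ (l, p i) = 1" using X p ik by (simp add: perm_matrices_def)
    then show "i = k" using p[of i] p[of k] ik by auto
  qed
  have "p ` {..<n} = {..<n}"
    using inj p by (intro endo_inj_surj) auto
  then have "p permutes {..<n}"
    using inj by (intro bij_imp_permutes) (auto simp: bij_betw_def p_def)
  moreover have "X = perm_mat n p"
  proof (rule eq_matI)
    fix i j assume "i < dim_row (perm_mat n p)" "j < dim_col (perm_mat n p)"
    then have ij: "i < n" "j < n" by (auto simp: perm_mat_def)
    have "X $$ (i, j) = 0 \<or> X $$ (i, j) = 1" using X ij by (simp add: perm_matrices_def)
    moreover have "X $$ (i, j) = 1 \<longleftrightarrow> j = p i" using p(2) p_eq ij by blast
    ultimately show "X $$ (i, j) = perm_mat n p $$ (i, j)"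
      using ij by (auto simp: perm_mat_def)
  qed (use X in \<open>auto simp: perm_matrices_def perm_mat_def\<close>)
  ultimately show "X \<in> perm_mat n ` {p. p permutes {..<n}}" by blast
qed (auto intro: perm_mat_in_perm_matrices)

lemma perm_mat_mult_vec:
  assumes "p permutes {..<n}" "s \<in> carrier_vec n" "i < n"
  shows "(perm_mat n p *\<^sub>v s) $ i = s $ p i"
proof -
  have "p i < n" using permutes_in_image[OF assms(1), of i] assms(3) by simp
  have "(perm_mat n p *\<^sub>v s) $ i = (\<Sum>j = 0..<n. (if j = p i then 1 else 0) * s $ j)"
    using assms by (auto simp: perm_mat_def scalar_prod_def intro!: sum.cong)
  also have "\<dots> = (\<Sum>j = 0..<n. if j = p i then s $ j else 0)"
    by (rule sum.cong) auto
  also have "\<dots> = s $ p i" using \<open>p i < n\<close> by simp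
  finally show ?thesis .
qed

text \<open>Entry \<open>i\<close> of the product is \<open>s $ p i\<close>. As the entries of
  \<open>s\<close> are distinct, this reveals \<open>p i\<close> for \<open>i < n\<close>, and
  elsewhere every permutation of \<open>{..<n}\<close> is the identity.\<close>

lemma inj_on_perm_mat_mult_vec:
  assumes s: "s \<in> carrier_vec n"
    and distinct: "\<And>i j. i < n \<Longrightarrow> j < n \<Longrightarrow> i \<noteq> j \<Longrightarrow> s $ i \<noteq> s $ j"
  shows "inj_on (\<lambda>p. perm_mat n p *\<^sub>v s) {p. p permutes {..<n}}"
proof (rule inj_onI, clarify)
  fix p q assume p: "p permutes {..<n}" and q: "q permutes {..<n}"
    and eq: "perm_mat n p *\<^sub>v s = perm_mat n q *\<^sub>v s"
  show "p = q"
  proof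
    fix i
    show "p i = q i"
    proof (cases "i < n")
      case True
      then have "s $ p i = s $ q i"
        using perm_mat_mult_vec[OF p s] perm_mat_mult_vec[OF q s] eq by metis
      moreover have "p i < n" "q i < n"
        using True permutes_in_image[OF p, of i] permutes_in_image[OF q, of i] by auto
      ultimately show ?thesis using distinct by blast
    next
      case False
      then show ?thesis using permutes_not_in[OF p] permutes_not_in[OF q] by simp
    qed
  qed
qed

lemma inj_on_perm_matrices_mult_vec:
  assumes "s \<in> carrier_vec n"
    and "\<And>i j. i < n \<Longrightarrow> j < n \<Longrightarrow> i \<noteq> j \<Longrightarrow> s $ i \<noteq> s $ j"
  shows "inj_on (\<lambda>X. X *\<^sub>v s) (perm_matrices n)"
  using inj_on_perm_mat_mult_vec[OF assms] unfolding perm_matrices_eq inj_on_def by auto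

lemma inj_on_perm_mat: "inj_on (perm_mat n) {p. p permutes {..<n}}"
proof -
  \<comment> \<open>The vector with entries 0, ..., n - 1 serves as a concrete one with distinct
    entries: permutations that it separates must have different matrices.\<close>
  let ?s = "vec n real"
  have "inj_on (\<lambda>p. perm_mat n p *\<^sub>v ?s) {p. p permutes {..<n}}"
    by (rule inj_on_perm_mat_mult_vec) auto
  then show ?thesis by (auto simp: inj_on_def)
qed

lemma card_perm_matrices: "card (perm_matrices n) = fact n"
  by (simp add: perm_matrices_eq card_image[OF inj_on_perm_mat] card_permutations)

lemma finite_perm_matrices: "finite (perm_matrices n)"
  by (simp add: perm_matrices_eq finite_permutations)

section \<open>Vectorized permutation matrices\<close>

text \<open>The one in row \<open>i\<close> of \<open>perm_mat n p\<close> moves to position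
  \<open>i * n + p i\<close>. Since \<open>p i < n\<close>, division by \<open>n\<close> recovers
  \<open>i\<close>, so the \<open>n\<close> rows contribute \<open>n\<close> different
  positions.\<close>

lemma vectorize_perm_matrix:
  assumes X: "X \<in> perm_matrices n"
  shows "dim_vec (vectorize X) = n\<^sup>2"
    and "\<And>k. k < n\<^sup>2 \<Longrightarrow> vectorize X $ k \<in> {0, 1}"
    and "card {k. k < n\<^sup>2 \<and> vectorize X $ k = 1} = n"
proof -
  have dims: "dim_row X = n" "dim_col X = n" using X by (auto simp: perm_matrices_def)
  then show "dim_vec (vectorize X) = n\<^sup>2" by (simp add: vectorize_def power2_eq_square)
  have divmod: "k div n < n" "k mod n < n" if "k < n\<^sup>2" for k
    using that by (cases "n = 0"; simp add: power2_eq_square less_mult_imp_div_less)+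
  have nth: "vectorize X $ k = X $$ (k div n, k mod n)" if "k < n\<^sup>2" for k
    using that dims by (simp add: vectorize_def power2_eq_square)
  show "vectorize X $ k \<in> {0, 1}" if "k < n\<^sup>2" for k
    using X nth[OF that] divmod[OF that] by (simp add: perm_matrices_def)
  obtain p where p: "p permutes {..<n}" and X_eq: "X = perm_mat n p"
    using X perm_matrices_eq by auto
  have lt: "p i < n" if "i < n" for i
    using permutes_in_image[OF p, of i] that by simp
  have "{k. k < n\<^sup>2 \<and> vectorize X $ k = 1} = (\<lambda>i. i * n + p i) ` {..<n}"
  proof (intro subset_antisym subsetI)
    fix k assume "k \<in> {k. k < n\<^sup>2 \<and> vectorize X $ k = 1}"
    then have k: "k < n\<^sup>2" "vectorize X $ k = 1" by auto
    then have "k mod n = p (k div n)"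
      using nth divmod by (simp add: X_eq perm_mat_def split: if_splits)
    then have "k = (k div n) * n + p (k div n)" by (metis div_mult_mod_eq)
    then show "k \<in> (\<lambda>i. i * n + p i) ` {..<n}" using divmod[OF k(1)] by blast
  next
    fix k assume "k \<in> (\<lambda>i. i * n + p i) ` {..<n}"
    then obtain i where i: "i < n" and k: "k = i * n + p i" by auto
    have "k < (i + 1) * n" using lt[OF i] k by simp
    also have "\<dots> \<le> n * n" using i by (intro mult_right_mono) auto
    finally have "k < n\<^sup>2" by (simp add: power2_eq_square)
    moreover have "k div n = i" "k mod n = p i" using lt[OF i] k by auto
    ultimately show "k \<in> {k. k < n\<^sup>2 \<and> vectorize X $ k = 1}"
      using nth i lt[OF i] by (simp add: X_eq perm_mat_def)
  qed
  moreover have "inj_on (\<lambda>i. i * n + p i) {..<n}"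
  proof (rule inj_onI)
    fix i j assume "i \<in> {..<n}" "j \<in> {..<n}" "i * n + p i = j * n + p j"
    then have "(i * n + p i) div n = (j * n + p j) div n" "p i < n" "p j < n"
      using lt by auto
    then show "i = j" by simp
  qed
  ultimately show "card {k. k < n\<^sup>2 \<and> vectorize X $ k = 1} = n"
    by (simp add: card_image)
qed

section \<open>Matrices as families of row supports\<close>

definition row_support :: "real mat \<Rightarrow> nat \<Rightarrow> nat set" where
  "row_support A i = {j. j < dim_col A \<and> A $$ (i, j) = 1}"

definition pairs :: "nat \<Rightarrow> nat set set" where
  "pairs N = {e. e \<subseteq> {..<N} \<and> card e = 2}"

lemma finite_pairs: "finite (pairs N)"
  by (rule finite_subset[of _ "Pow {..<N}"]) (auto simp: pairs_def)

lemma card_pairs: "card (pairs N) = N choose 2"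
  using n_subsets[of "{..<N}" 2] by (simp add: pairs_def)

lemma row_support_in_pairs:
  assumes "A \<in> two_ones_matrices m n" "i < m"
  shows "row_support A i \<in> pairs (n\<^sup>2)"
  using assms by (auto simp: two_ones_matrices_def row_support_def pairs_def)

text \<open>A 0/1 matrix is determined by the supports of its rows, and these can be prescribed
  independently. The set \<open>F\<close> is kept general because two instances are counted: all
  pairs, which gives the size of the sample space, and the pairs on which a fixed vectorized
  permutation matrix is constant.\<close>

lemma bij_betw_row_supports:
  assumes F: "F \<subseteq> pairs (n\<^sup>2)"
  shows "bij_betw (\<lambda>A. \<lambda>i\<in>{..<m}. row_support A i)
    {A \<in> two_ones_matrices m n. \<forall>i<m. row_support A i \<in> F} ({..<m} \<rightarrow>\<^sub>E F)"
proof (rule bij_betw_byWitness)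
  let ?S = "{A \<in> two_ones_matrices m n. \<forall>i<m. row_support A i \<in> F}"
  let ?supp = "\<lambda>A. \<lambda>i\<in>{..<m}. row_support A i"
  let ?mat = "\<lambda>f. mat m (n\<^sup>2) (\<lambda>(i, j). if j \<in> f i then 1 else 0) :: real mat"
  have supp_mat: "row_support (?mat f) i = f i" if "f \<in> {..<m} \<rightarrow>\<^sub>E F" "i < m" for f i
  proof -
    have "f i \<in> pairs (n\<^sup>2)" using that F by auto
    then show ?thesis using that by (auto simp: row_support_def pairs_def split: if_splits)
  qed
  show "\<forall>A\<in>?S. ?mat (?supp A) = A"
  proof
    fix A assume "A \<in> ?S"
    then have A: "A \<in> carrier_mat m (n\<^sup>2)" "\<And>i j. i < m \<Longrightarrow> j < n\<^sup>2 \<Longrightarrow> A $$ (i, j) \<in> {0, 1}"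
      by (auto simp: two_ones_matrices_def)
    show "?mat (?supp A) = A"
      by (rule eq_matI) (use A in \<open>force simp: row_support_def\<close>)+
  qed
  show "\<forall>f\<in>{..<m} \<rightarrow>\<^sub>E F. ?supp (?mat f) = f"
    using supp_mat by (auto simp: fun_eq_iff PiE_def extensional_def)
  show "?supp ` ?S \<subseteq> {..<m} \<rightarrow>\<^sub>E F" by auto
  show "?mat ` ({..<m} \<rightarrow>\<^sub>E F) \<subseteq> ?S"
  proof (rule image_subsetI)
    fix f assume f: "f \<in> {..<m} \<rightarrow>\<^sub>E F"
    have in_F: "row_support (?mat f) i \<in> F" if "i < m" for i
      using supp_mat[OF f that] f that by auto
    then have "card {j. j < n\<^sup>2 \<and> ?mat f $$ (i, j) = 1} = 2" if "i < m" for i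
      using F that by (fastforce simp: row_support_def pairs_def)
    with in_F show "?mat f \<in> ?S"
      by (auto simp: two_ones_matrices_def)
  qed
qed

lemma card_two_ones_matrices_rows_in:
  assumes "F \<subseteq> pairs (n\<^sup>2)"
  shows "card {A \<in> two_ones_matrices m n. \<forall>i<m. row_support A i \<in> F} = card F ^ m"
  using bij_betw_same_card[OF bij_betw_row_supports[OF assms]] by (simp add: card_PiE)

lemma two_ones_matrices_rows_in_pairs:
  "{A \<in> two_ones_matrices m n. \<forall>i<m. row_support A i \<in> pairs (n\<^sup>2)} = two_ones_matrices m n"
  using row_support_in_pairs by blast

lemma card_two_ones_matrices: "card (two_ones_matrices m n) = (n\<^sup>2 choose 2) ^ m"
  using card_two_ones_matrices_rows_in[of "pairs (n\<^sup>2)" n m]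
  by (simp only: two_ones_matrices_rows_in_pairs card_pairs subset_refl)

lemma finite_two_ones_matrices: "finite (two_ones_matrices m n)"
  using bij_betw_finite[OF bij_betw_row_supports[of "pairs (n\<^sup>2)" n m]]
  by (simp add: two_ones_matrices_rows_in_pairs finite_PiE finite_pairs)

section \<open>Matrices whose equations a fixed permutation matrix satisfies\<close>

text \<open>If the two ones of the row stand at \<open>a < b\<close>, the flipped row has -1 at
  \<open>a\<close> and 1 at \<open>b\<close>, so its product with \<open>v\<close> is
  \<open>v $ b - v $ a\<close>. The right-hand side depends only on the support as a set, which is
  the form needed for counting.\<close>

lemma flip_first_row_eq_0_iff:
  assumes A: "A \<in> two_ones_matrices m n" and i: "i < m" and v: "dim_vec v = n\<^sup>2"
  shows "(flip_first A *\<^sub>v v) $ i = 0 \<longleftrightarrow>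
    (\<forall>j\<in>row_support A i. \<forall>k\<in>row_support A i. v $ j = v $ k)"
proof -
  have dims: "dim_row A = m" "dim_col A = n\<^sup>2"
    and entries: "\<And>j. j < n\<^sup>2 \<Longrightarrow> A $$ (i, j) \<in> {0, 1}"
    using A i by (auto simp: two_ones_matrices_def)
  have "row_support A i \<in> pairs (n\<^sup>2)" using A i by (rule row_support_in_pairs)
  then obtain a b where supp: "row_support A i = {a, b}" and "a \<noteq> b"
    unfolding pairs_def by (auto simp: card_2_iff)
  \<comment> \<open>The order matters: only the earlier of the two ones changes sign.\<close>
  then obtain a b where supp: "row_support A i = {a, b}" and ab: "a < b"
    by (metis insert_commute linorder_neqE_nat)
  have bounds: "a < n\<^sup>2" "b < n\<^sup>2" and ones: "A $$ (i, a) = 1" "A $$ (i, b) = 1"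
    using supp dims by (auto simp: row_support_def)
  have zeros: "A $$ (i, j) = 0" if "j < n\<^sup>2" "j \<noteq> a" "j \<noteq> b" for j
    using entries[of j] supp that dims by (auto simp: row_support_def)
  have flip: "flip_first A $$ (i, j) = (if j = a then -1 else 0) + (if j = b then 1 else 0)"
    if "j < n\<^sup>2" for j
  proof -
    have "\<forall>j'<a. A $$ (i, j') = 0" using zeros ab bounds by auto
    moreover have "\<not> (\<forall>j'<b. A $$ (i, j') = 0)" using ones ab by auto
    ultimately show ?thesis
      using that zeros[of j] ones ab i dims by (auto simp: flip_first_def)
  qed
  have "(flip_first A *\<^sub>v v) $ i = (\<Sum>j = 0..<n\<^sup>2. flip_first A $$ (i, j) * v $ j)"
    using i v dims by (auto simp: flip_first_def scalar_prod_def intro!: sum.cong)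
  also have "\<dots> = (\<Sum>j = 0..<n\<^sup>2. (if j = a then - v $ j else 0) + (if j = b then v $ j else 0))"
    by (rule sum.cong) (auto simp: flip)
  also have "\<dots> = v $ b - v $ a"
    using bounds by (simp add: sum.distrib)
  finally show ?thesis using supp by auto
qed

text \<open>A vector with entries 0 and 1 is constant on a pair exactly when the pair lies within
  the positions of the ones (\<open>?I\<close>) or within those of the zeros (\<open>?O\<close>).
  The two kinds of pairs are counted separately.\<close>

lemma card_pairs_constant:
  fixes v :: "real vec"
  assumes "\<And>k. k < N \<Longrightarrow> v $ k \<in> {0, 1}"
    and ones: "card {k. k < N \<and> v $ k = 1} = n"
  shows "card {e \<in> pairs N. \<forall>j\<in>e. \<forall>k\<in>e. v $ j = v $ k} = (n choose 2) + ((N - n) choose 2)"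
proof -
  let ?I = "{k. k < N \<and> v $ k = 1}" and ?O = "{..<N} - {k. k < N \<and> v $ k = 1}"
  have "card ?O = N - n"
    using ones by (subst card_Diff_subset) auto
  have eq: "{e \<in> pairs N. \<forall>j\<in>e. \<forall>k\<in>e. v $ j = v $ k}
      = {e. e \<subseteq> ?I \<and> card e = 2} \<union> {e. e \<subseteq> ?O \<and> card e = 2}" (is "?L = ?R")
  proof (intro subset_antisym subsetI)
    fix e assume "e \<in> ?L"
    then have e: "e \<subseteq> {..<N}" "card e = 2" "\<forall>j\<in>e. \<forall>k\<in>e. v $ j = v $ k"
      unfolding pairs_def by blast+
    show "e \<in> ?R"
    proof (cases "\<exists>j\<in>e. v $ j = 1")
      case True
      then have "\<forall>k\<in>e. v $ k = 1" using e(3) by metis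
      then show ?thesis using e(1,2) by auto
    next
      case False
      then show ?thesis using e(1,2) by auto
    qed
  next
    fix e assume e: "e \<in> ?R"
    have "v $ k = 0" if "k \<in> ?O" for k using assms(1)[of k] that by auto
    then have "(\<forall>k\<in>e. v $ k = 1) \<or> (\<forall>k\<in>e. v $ k = 0)" using e by blast
    then have "\<forall>j\<in>e. \<forall>k\<in>e. v $ j = v $ k" by metis
    moreover have "e \<in> pairs N" using e by (auto simp: pairs_def)
    ultimately show "e \<in> ?L" by blast
  qed
  have "card ?R = card {e. e \<subseteq> ?I \<and> card e = 2} + card {e. e \<subseteq> ?O \<and> card e = 2}"
  proof (rule card_Un_disjoint)
    show "finite {e. e \<subseteq> ?I \<and> card e = 2}" by (rule finite_subset[of _ "Pow ?I"]) auto
    show "finite {e. e \<subseteq> ?O \<and> card e = 2}" by (rule finite_subset[of _ "Pow ?O"]) auto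
    \<comment> \<open>No pair is counted twice: \<open>?I\<close> and \<open>?O\<close> are
      disjoint, so only the empty set is contained in both.\<close>
    have "card e \<noteq> 2" if "e \<subseteq> ?I" "e \<subseteq> ?O" for e
    proof -
      have "e = {}" using that by blast
      then show ?thesis by simp
    qed
    then show "{e. e \<subseteq> ?I \<and> card e = 2} \<inter> {e. e \<subseteq> ?O \<and> card e = 2} = {}" by blast
  qed
  also have "\<dots> = (n choose 2) + ((N - n) choose 2)"
  proof -
    have "finite ?I" "finite ?O" by simp_all
    then show ?thesis by (simp only: n_subsets ones \<open>card ?O = N - n\<close>)
  qed
  finally show ?thesis unfolding eq .
qed

text \<open>The equations hold iff every row support belongs to the set \<open>?F\<close> of pairs
  on which \<open>vectorize X\<close> is constant. The choices for the \<open>m\<close> rows are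
  independent, whence the power. The base follows from the \<open>n\<close> ones among the
  \<open>n\<^sup>2\<close> entries of \<open>X\<close>.\<close>

lemma card_satisfying_two_ones_matrices:
  assumes X: "X \<in> perm_matrices n"
  shows "card {A \<in> two_ones_matrices m n. \<forall>i<m. (flip_first A *\<^sub>v vectorize X) $ i = 0}
    = ((n choose 2) + ((n\<^sup>2 - n) choose 2)) ^ m"
proof -
  let ?F = "{e \<in> pairs (n\<^sup>2). \<forall>j\<in>e. \<forall>k\<in>e. vectorize X $ j = vectorize X $ k}"
  have "{A \<in> two_ones_matrices m n. \<forall>i<m. (flip_first A *\<^sub>v vectorize X) $ i = 0}
      = {A \<in> two_ones_matrices m n. \<forall>i<m. row_support A i \<in> ?F}"
    using flip_first_row_eq_0_iff[OF _ _ vectorize_perm_matrix(1)[OF X]] row_support_in_pairs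
    by blast
  then show ?thesis
    using card_two_ones_matrices_rows_in[of ?F n m]
      card_pairs_constant[OF vectorize_perm_matrix(2,3)[OF X]] by simp
qed

section \<open>Code sizes and their expectation\<close>

lemma card_perm_code:
  assumes A: "A \<in> two_ones_matrices m n" and s: "s \<in> carrier_vec n"
    and distinct: "\<And>i j. i < n \<Longrightarrow> j < n \<Longrightarrow> i \<noteq> j \<Longrightarrow> s $ i \<noteq> s $ j"
  shows "card (perm_code (flip_first A) (0\<^sub>v m) (\<lambda>_. (=)) s)
    = card {X \<in> perm_matrices n. \<forall>i<m. (flip_first A *\<^sub>v vectorize X) $ i = 0}"
    (is "_ = card ?Y")
proof -
  have "dim_row (flip_first A) = m" using A by (auto simp: two_ones_matrices_def flip_first_def)
  then have "perm_code (flip_first A) (0\<^sub>v m) (\<lambda>_. (=)) s = (\<lambda>X. X *\<^sub>v s) ` ?Y"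
    \<comment> \<open>Without \<open>index_mult_mat_vec\<close> the row condition is not expanded
      into a scalar product and keeps the shape that it has in \<open>?Y\<close>.\<close>
    using s by (auto simp: perm_code_def simp del: index_mult_mat_vec)
  moreover have "inj_on (\<lambda>X. X *\<^sub>v s) ?Y"
    by (rule inj_on_subset[OF inj_on_perm_matrices_mult_vec[OF s distinct]]) auto
  ultimately show ?thesis by (simp add: card_image)
qed

theorem lemma4:
  fixes n m :: nat and s :: "real vec"
  assumes "n \<ge> 2" and "m \<ge> 1"
    and "s \<in> carrier_vec n"
    and "\<And>i j. i < n \<Longrightarrow> j < n \<Longrightarrow> i \<noteq> j \<Longrightarrow> s $ i \<noteq> s $ j"
  shows "measure_pmf.expectation (pmf_of_set (two_ones_matrices m n))
           (\<lambda>A. real (card (perm_code (flip_first A) (0\<^sub>v m) (\<lambda>_. (=)) s)))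
         = fact n * ((real (n choose 2) + real ((n\<^sup>2 - n) choose 2)) / real (n\<^sup>2 choose 2)) ^ m"
proof -
  let ?S = "two_ones_matrices m n" and ?P = "perm_matrices n"
  let ?sat = "\<lambda>A X. \<forall>i<m. (flip_first A *\<^sub>v vectorize X) $ i = 0"
  let ?c = "(n choose 2) + ((n\<^sup>2 - n) choose 2)"
  \<comment> \<open>From \<open>n \<ge> 2\<close> there are at least four positions, so
    \<open>n\<^sup>2 choose 2\<close> is positive and the sample space is nonempty, as
    \<open>integral_pmf_of_set\<close> requires.\<close>
  have "2\<^sup>2 \<le> n\<^sup>2" using assms(1) by (rule power_mono) simp
  then have "card ?S \<noteq> 0" by (simp add: card_two_ones_matrices)
  then have "?S \<noteq> {}" by auto
  have "(\<Sum>A\<in>?S. card (perm_code (flip_first A) (0\<^sub>v m) (\<lambda>_. (=)) s))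
      = (\<Sum>A\<in>?S. card {X \<in> ?P. ?sat A X})"
    using assms(3,4) by (intro sum.cong refl card_perm_code) auto
  \<comment> \<open>Double counting of the pairs \<open>(A, X)\<close> with \<open>?sat A X\<close>.
    Grouped by \<open>X\<close>, every one of the \<open>fact n\<close> summands has the same value
    \<open>?c ^ m\<close>.\<close>
  also have "\<dots> = (\<Sum>X\<in>?P. card {A \<in> ?S. ?sat A X})"
    by (rule sum_multicount_gen[OF finite_two_ones_matrices finite_perm_matrices]) simp
  also have "\<dots> = fact n * ?c ^ m"
    by (simp add: card_satisfying_two_ones_matrices card_perm_matrices
        del: index_mult_mat_vec)
  finally have total: "(\<Sum>A\<in>?S. card (perm_code (flip_first A) (0\<^sub>v m) (\<lambda>_. (=)) s))
      = fact n * ?c ^ m" .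
  have "measure_pmf.expectation (pmf_of_set ?S)
      (\<lambda>A. real (card (perm_code (flip_first A) (0\<^sub>v m) (\<lambda>_. (=)) s)))
      = real (\<Sum>A\<in>?S. card (perm_code (flip_first A) (0\<^sub>v m) (\<lambda>_. (=)) s)) / real (card ?S)"
    by (simp add: integral_pmf_of_set[OF \<open>?S \<noteq> {}\<close> finite_two_ones_matrices])
  also have "\<dots> = fact n * ((real (n choose 2) + real ((n\<^sup>2 - n) choose 2)) / real (n\<^sup>2 choose 2)) ^ m"
    unfolding total card_two_ones_matrices by (simp add: power_divide)
  finally show ?thesis .
qed

end
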